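(* Let $a\in\mathbb{R}$ be fixed with $\frac{a}{9}\notin\{0,-\frac19,-1\}$. The locus of points $P=(x,y,z)$ for which the point $Z$ is ordinary and $\frac{GZ}{ZV}=\frac{a}{9}$ coincides with the set of (real projective) points on the elliptic curve $$E_a:\ x^2(y+z)+y^2(x+z)+z^2(x+y)+(a+3)xyz=0,$$ minus the points in the set $$T=\{(1,0,0),(0,1,0),(0,0,1),(0,1,-1),(1,0,-1),(1,-1,0)\}.$$ In particular, for fixed real $a\notin\{3,0,-1,-9\}$, the locus of points $P$ for which the homothety ratio of the map $\mathsf{M}=T_P\circ K^{-1}\circ T_{P'}$ is $k=\frac{4}{a+1}$ is an elliptic curve minus the points on the sides of triangle $ABC$.
   Context: Let $ABC$ be a (nondegenerate) triangle in the real plane, extended by the line at infinity to the real projective plane. Points are written in homogeneous barycentric coordinates with respect to $ABC$, so $A=(1,0,0)$, $B=(0,1,0)$, $C=(0,0,1)$, centroid $G=(1,1,1)$; the line at infinity is $x+y+z=0$, and a point is ordinary if it is not on that line. The complement map $K$ is the affine map (homothety with center $G$ and ratio $-\frac12$) acting by $K(x,y,z)=(y+z,x+z,x+y)$; the anticomplementary triangle $K^{-1}(ABC)$ has sides $y+z=0$, $x+z=0$, $x+y=0$. Throughout, $P=(x,y,z)$ is a point not on any side line of $ABC$ (so $xyz\ne 0$) or of $K^{-1}(ABC)$ (so $(x+y)(x+z)(y+z)\neq 0$), and $P'=(yz,xz,xy)$ is its isotomic conjugate. $T_P$ is the unique affine map sending $A,B,C$ respectively to the traces $D=(0,y,z)$,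 $E=(x,0,z)$, $F=(x,y,0)$ of $P$ on $BC,CA,AB$; $T_{P'}$ is the unique affine map sending $A,B,C$ respectively to the traces $D_3=(0,z,y)$, $E_3=(z,0,x)$, $F_3=(y,x,0)$ of $P'$. The map $\mathsf{M}=T_P\circ K^{-1}\circ T_{P'}$ is a homothety or a translation. Define $$Z=(x(y-z)^2,\ y(z-x)^2,\ z(x-y)^2),\qquad V=(x(y^2+yz+z^2),\ y(x^2+xz+z^2),\ z(x^2+xy+y^2)).$$ The triple defining $Z$ is $(0,0,0)$ when $P=G$; in that case $Z$ is not a point, so $P=G$ is not in the first locus. The points $G,Z,V$ are collinear, and for ordinary $Z$ and $V$ the signed ratio $\frac{GZ}{ZV}$ is the real number $r$ with $\overrightarrow{GZ}=r\,\overrightarrow{ZV}$; the condition $\frac{GZ}{ZV}=\frac a9$ includes the requirement that $V$ is ordinary. *)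

theory Defs
  imports "HOL-Analysis.Analysis"
begin

section \<open>The real projective plane in homogeneous coordinates\<close>

type_synonym triple = "real \<times> real \<times> real"

definition proportional :: "triple \<Rightarrow> triple \<Rightarrow> bool" where
  "proportional u v \<longleftrightarrow> u \<noteq> 0 \<and> v \<noteq> 0 \<and> (\<exists>c. v = c *\<^sub>R u)"

lemma proportional_part_equivp: "part_equivp proportional"
proof (rule part_equivpI)
  show "\<exists>u. proportional u u"
    by (intro exI[of _ "(1, 0, 0)"]) (auto simp: proportional_def zero_prod_def intro: exI[of _ 1])
  show "symp proportional"
  proof (rule sympI)
    fix u v assume "proportional u v"
    then obtain c where c: "u \<noteq> 0" "v \<noteq> 0" "v = c *\<^sub>R u"
      by (auto simp: proportional_def)
    then have "u = inverse c *\<^sub>R v" by auto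
    with c show "proportional v u" unfolding proportional_def by blast
  qed
  show "transp proportional"
    by (rule transpI) (auto simp: proportional_def)
qed

quotient_type proj_point = triple / partial: proportional
  by (rule proportional_part_equivp)

text \<open>The point with homogeneous coordinates \<open>(x, y, z)\<close>; meaningful only if
  \<open>(x, y, z) \<noteq> (0, 0, 0)\<close>.\<close>
definition hpoint :: "real \<Rightarrow> real \<Rightarrow> real \<Rightarrow> proj_point" where
  "hpoint x y z = abs_proj_point (x, y, z)"

lemma hpoint_eq_iff:
  assumes "(x, y, z) \<noteq> (0, 0, 0)" "(x', y', z') \<noteq> (0, 0, 0)"
  shows "hpoint x y z = hpoint x' y' z' \<longleftrightarrow>
    (\<exists>c. x' = c * x \<and> y' = c * y \<and> z' = c * z)"
proof -
  have refl: "proportional u u" if "u \<noteq> 0" for u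
    using that by (auto simp: proportional_def intro: exI[of _ 1])
  have "hpoint x y z = hpoint x' y' z' \<longleftrightarrow> proportional (x, y, z) (x', y', z')"
    unfolding hpoint_def using assms
    by (subst Quotient_rel[OF Quotient_proj_point, symmetric])
      (auto simp: zero_prod_def intro!: refl)
  then show ?thesis
    using assms by (auto simp: proportional_def zero_prod_def)
qed

section \<open>Barycentric coordinates with respect to a triangle\<close>

fun ordinary :: "triple \<Rightarrow> bool" where
  "ordinary (x, y, z) \<longleftrightarrow> x + y + z \<noteq> 0"

fun bary :: "real^2 \<Rightarrow> real^2 \<Rightarrow> real^2 \<Rightarrow> triple \<Rightarrow> real^2" where
  "bary A B C (x, y, z) = (1 / (x + y + z)) *\<^sub>R (x *\<^sub>R A + y *\<^sub>R B + z *\<^sub>R C)"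

text \<open>The condition on \<open>P = (x, y, z)\<close> imposed throughout: \<open>P\<close> lies on no side line of \<open>ABC\<close>
  and on no side line of its anticomplementary triangle.\<close>
fun admissible :: "triple \<Rightarrow> bool" where
  "admissible (x, y, z) \<longleftrightarrow> x * y * z \<noteq> 0 \<and> (x + y) * (x + z) * (y + z) \<noteq> 0"

fun isotomic :: "triple \<Rightarrow> triple" where
  "isotomic (x, y, z) = (y * z, x * z, x * y)"

fun Z_point :: "triple \<Rightarrow> triple" where
  "Z_point (x, y, z) = (x * (y - z)^2, y * (z - x)^2, z * (x - y)^2)"

fun V_point :: "triple \<Rightarrow> triple" where
  "V_point (x, y, z) =
    (x * (y^2 + y * z + z^2), y * (x^2 + x * z + z^2), z * (x^2 + x * y + y^2))"

text \<open>\<open>signed_ratio X Y W r\<close> says that the signed ratio \<open>XY / YW\<close> of the three points exists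
  and equals \<open>r\<close>.\<close>
definition signed_ratio :: "real^2 \<Rightarrow> real^2 \<Rightarrow> real^2 \<Rightarrow> real \<Rightarrow> bool" where
  "signed_ratio X Y W r \<longleftrightarrow> Y \<noteq> W \<and> Y - X = r *\<^sub>R (W - Y)"

section \<open>The affine maps\<close>

definition affine_map :: "(real^2 \<Rightarrow> real^2) \<Rightarrow> bool" where
  "affine_map f \<longleftrightarrow> (\<exists>L b. linear L \<and> f = (\<lambda>X. L X + b))"

text \<open>The affine map taking \<open>A\<close>, \<open>B\<close>, \<open>C\<close> to the traces of \<open>P\<close>; it exists and is unique when
  \<open>ABC\<close> is nondegenerate.\<close>
fun trace_map :: "real^2 \<Rightarrow> real^2 \<Rightarrow> real^2 \<Rightarrow> triple \<Rightarrow> real^2 \<Rightarrow> real^2" where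
  "trace_map A B C (x, y, z) = (THE f. affine_map f \<and>
     f A = bary A B C (0, y, z) \<and> f B = bary A B C (x, 0, z) \<and> f C = bary A B C (x, y, 0))"

definition homothety :: "real^2 \<Rightarrow> real \<Rightarrow> real^2 \<Rightarrow> real^2" where
  "homothety Q k X = Q + k *\<^sub>R (X - Q)"

definition homothety_with_ratio :: "(real^2 \<Rightarrow> real^2) \<Rightarrow> real \<Rightarrow> bool" where
  "homothety_with_ratio f k \<longleftrightarrow> k \<noteq> 0 \<and> (\<exists>Q. f = homothety Q k)"

definition complement_map :: "real^2 \<Rightarrow> real^2 \<Rightarrow> real^2 \<Rightarrow> real^2 \<Rightarrow> real^2" where
  "complement_map A B C = homothety (bary A B C (1, 1, 1)) (- 1 / 2)"

definition M_map :: "real^2 \<Rightarrow> real^2 \<Rightarrow> real^2 \<Rightarrow> triple \<Rightarrow> real^2 \<Rightarrow> real^2" where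
  "M_map A B C P =
     trace_map A B C P \<circ> inv (complement_map A B C) \<circ> trace_map A B C (isotomic P)"

section \<open>Plane cubics and elliptic curves over the reals\<close>

text \<open>A plane curve is given by the complex function of its defining form.\<close>
type_synonym ternary = "complex \<Rightarrow> complex \<Rightarrow> complex \<Rightarrow> complex"

definition real_cubic_form :: "ternary \<Rightarrow> bool" where
  "real_cubic_form F \<longleftrightarrow> (\<exists>c :: nat \<Rightarrow> nat \<Rightarrow> real. \<forall>x y z.
     F x y z = (\<Sum>i\<le>3. \<Sum>j\<le>3 - i. of_real (c i j) * x ^ i * y ^ j * z ^ (3 - i - j)))"

definition nonsingular :: "ternary \<Rightarrow> bool" where
  "nonsingular F \<longleftrightarrow> (\<forall>x y z. (x, y, z) \<noteq> (0, 0, 0) \<and> F x y z = 0 \<longrightarrow>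
     \<not> (deriv (\<lambda>t. F t y z) x = 0 \<and> deriv (\<lambda>t. F x t z) y = 0 \<and> deriv (\<lambda>t. F x y t) z = 0))"

definition real_points :: "ternary \<Rightarrow> proj_point set" where
  "real_points F = {hpoint x y z | x y z.
     (x, y, z) \<noteq> (0, 0, 0) \<and> F (of_real x) (of_real y) (of_real z) = 0}"

text \<open>Nonsingularity is required at all complex points, so the cubic is geometrically
  smooth and irreducible.\<close>
definition elliptic_curve :: "ternary \<Rightarrow> bool" where
  "elliptic_curve F \<longleftrightarrow> real_cubic_form F \<and> nonsingular F \<and> real_points F \<noteq> {}"

definition E_curve :: "real \<Rightarrow> ternary" where
  "E_curve a x y z =
     x^2 * (y + z) + y^2 * (x + z) + z^2 * (x + y) + (of_real a + 3) * x * y * z"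

definition T_set :: "proj_point set" where
  "T_set = {hpoint 1 0 0, hpoint 0 1 0, hpoint 0 0 1,
            hpoint 0 1 (- 1), hpoint 1 0 (- 1), hpoint 1 (- 1) 0}"

definition side_points :: "proj_point set" where
  "side_points = {hpoint x y z | x y z. (x, y, z) \<noteq> (0, 0, 0) \<and> x * y * z = 0}"

section \<open>The two loci\<close>

definition ratio_locus :: "real^2 \<Rightarrow> real^2 \<Rightarrow> real^2 \<Rightarrow> real \<Rightarrow> proj_point set" where
  "ratio_locus A B C r = {hpoint x y z | x y z. admissible (x, y, z) \<and>
     ordinary (Z_point (x, y, z)) \<and> ordinary (V_point (x, y, z)) \<and>
     signed_ratio (bary A B C (1, 1, 1)) (bary A B C (Z_point (x, y, z)))
       (bary A B C (V_point (x, y, z))) r}"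

definition homothety_locus :: "real^2 \<Rightarrow> real^2 \<Rightarrow> real^2 \<Rightarrow> real \<Rightarrow> proj_point set" where
  "homothety_locus A B C k = {hpoint x y z | x y z. admissible (x, y, z) \<and>
     homothety_with_ratio (M_map A B C (x, y, z)) k}"

end

theory Submission
  imports Defs
begin

text \<open>
  Let \<open>s1, s2, s3\<close> be the elementary symmetric polynomials of \<open>x, y, z\<close>; the curve is
  \<open>s1 s2 + a s3 = 0\<close>. The coordinates of \<open>Z\<close> and \<open>V\<close> sum to \<open>s1 s2 - 9 s3\<close> and \<open>s1 s2\<close>, and the
  two triples differ by \<open>3 s3 (1, 1, 1)\<close>, so \<open>9 s3 (Z - G) = - s1 s2 (V - Z)\<close> and
  the signed ratio is \<open>- s1 s2 / (9 s3)\<close>. Evaluating the affine map \<open>M\<close> at the vertices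
  gives \<open>M A - M B = k (A - B)\<close> (and cyclically) with
  \<open>k = - 4 s3 / ((x + y) (x + z) (y + z)) = - 4 s3 / (s1 s2 - s3)\<close>, so the linear part of \<open>M\<close>
  is multiplication by \<open>k\<close>. Both ratio conditions therefore say that
  \<open>P\<close> lies on the curve. At a singular point the differences of the partial derivatives
  factor as \<open>(y - x) (s1 + a z)\<close> (and cyclically), which forces \<open>a \<in> {0, - 1, - 9}\<close>.
\<close>

section \<open>The cubic\<close>

text \<open>The form of \<open>E_curve\<close> at real arguments, with \<open>3 * x * y * z\<close>
  absorbed into the product of the first two symmetric polynomials.\<close>

definition cubic :: "real \<Rightarrow> real \<Rightarrow> real \<Rightarrow> real \<Rightarrow> real" where
  "cubic a x y z = (x + y + z) * (x * y + y * z + z * x) + a * (x * y * z)"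

lemma E_curve_of_real:
  "E_curve a (of_real x) (of_real y) (of_real z) = of_real (cubic a x y z)"
  by (simp add: E_curve_def cubic_def algebra_simps power2_eq_square)

lemma real_points_E_curve:
  "real_points (E_curve a) = {hpoint x y z | x y z. (x, y, z) \<noteq> (0, 0, 0) \<and> cubic a x y z = 0}"
  unfolding real_points_def E_curve_of_real of_real_eq_0_iff ..

lemma real_cubic_form_E_curve: "real_cubic_form (E_curve a)"
  unfolding real_cubic_form_def
proof (intro exI allI)
  fix x y z :: complex
  \<comment> \<open>The pairs (3, 0), (0, 3), (0, 0) index the pure cubes and (1, 1) indexes the
    monomial \<open>x * y * z\<close>.\<close>
  let ?c = "\<lambda>i j :: nat. if i = 1 \<and> j = 1 then a + 3
    else if i = 3 \<or> j = 3 \<or> i = 0 \<and> j = 0 then 0 else 1"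
  show "E_curve a x y z =
    (\<Sum>i\<le>3. \<Sum>j\<le>3 - i. of_real (?c i j) * x ^ i * y ^ j * z ^ (3 - i - j))"
    by (simp add: numeral_eq_Suc E_curve_def algebra_simps)
qed

section \<open>Smoothness over the complex numbers\<close>

lemma deriv_E_curve:
  fixes x y z :: complex
  shows "deriv (\<lambda>t. E_curve a t y z) x = 2 * x * (y + z) + y^2 + z^2 + (of_real a + 3) * y * z"
    and "deriv (\<lambda>t. E_curve a x t z) y = 2 * y * (x + z) + x^2 + z^2 + (of_real a + 3) * x * z"
    and "deriv (\<lambda>t. E_curve a x y t) z = 2 * z * (x + y) + x^2 + y^2 + (of_real a + 3) * x * y"
  unfolding E_curve_def
  by (rule DERIV_imp_deriv, (rule derivative_eq_intros refl | simp add: algebra_simps)+)+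

text \<open>The last two hypotheses are the vanishing of partial derivatives at \<open>(x, x, z)\<close>, with \<open>c = a\<close>.\<close>
lemma singular_two_equal:
  fixes x z c :: complex
  assumes ne: "(x, z) \<noteq> (0, 0)"
    and dx: "2 * x * (x + z) + x^2 + z^2 + (c + 3) * x * z = 0"
    and dz: "2 * z * (x + x) + x^2 + x^2 + (c + 3) * x * x = 0"
  shows "c = - 1 \<or> c = - 9"
proof -
  have x: "x \<noteq> 0"
    using ne dx by auto
  have "x * (4 * z + (c + 5) * x) = 0"
    using dz by algebra
  then have z: "4 * z = - (c + 5) * x"
    using x by algebra
  \<comment> \<open>Sixteen times \<open>dx\<close>, after substituting for \<open>4 * z\<close>,
    becomes \<open>- 3 * x^2 * ((c + 5)^2 - 16)\<close>.\<close>
  have "x^2 * ((c + 1) * (c + 9)) = 0"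
    using dx z by algebra
  then show ?thesis
    using x by (simp add: add_eq_0_iff2)
qed

lemma nonsingular_E_curve:
  assumes "a \<notin> {0, - 1, - 9}"
  shows "nonsingular (E_curve a)"
  unfolding nonsingular_def deriv_E_curve
proof (intro allI impI notI; elim conjE)
  fix x y z :: complex
  define c where "c = complex_of_real a"
  have c: "c \<noteq> 0" "c \<noteq> - 1" "c \<noteq> - 9"
    using assms by (auto simp: c_def complex_eq_iff)
  assume ne: "(x, y, z) \<noteq> (0, 0, 0)"
  assume "2 * x * (y + z) + y^2 + z^2 + (of_real a + 3) * y * z = 0"
    and "2 * y * (x + z) + x^2 + z^2 + (of_real a + 3) * x * z = 0"
    and "2 * z * (x + y) + x^2 + y^2 + (of_real a + 3) * x * y = 0"
  then have d: "2 * x * (y + z) + y^2 + z^2 + (c + 3) * y * z = 0"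
    "2 * y * (x + z) + x^2 + z^2 + (c + 3) * x * z = 0"
    "2 * z * (x + y) + x^2 + y^2 + (c + 3) * x * y = 0"
    by (simp_all add: c_def)
  \<comment> \<open>First partial minus second, and second minus third.\<close>
  have "(y - x) * (x + y + z + c * z) = 0" "(z - y) * (x + y + z + c * x) = 0"
    using d by algebra+
  then consider "x = y" | "y = z" | "x + y + z + c * z = 0" "x + y + z + c * x = 0"
    by auto
  then have "x = y \<or> y = z \<or> x = z"
  proof cases
    case 3
    then have "c * (x - z) = 0"
      by algebra
    then show ?thesis
      using c by simp
  qed auto
  \<comment> \<open>By symmetry each case is a singular point with a repeated coordinate, which is
    the first argument of \<open>singular_two_equal\<close>.\<close>
  then show False
  proof (elim disjE)
    assume "x = y"
    then show False
      using singular_two_equal[of x z c] d ne c by (auto simp: algebra_simps)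
  next
    assume "y = z"
    then show False
      using singular_two_equal[of y x c] d ne c by (auto simp: algebra_simps)
  next
    assume "x = z"
    then show False
      using singular_two_equal[of x y c] d ne c by (auto simp: algebra_simps)
  qed
qed

lemma elliptic_curve_E_curve:
  assumes "a \<notin> {0, - 1, - 9}"
  shows "elliptic_curve (E_curve a)"
proof -
  have "hpoint 1 0 0 \<in> real_points (E_curve a)"
    unfolding real_points_E_curve by (force simp: cubic_def)
  then show ?thesis
    using assms by (auto simp: elliptic_curve_def real_cubic_form_E_curve nonsingular_E_curve)
qed

text \<open>On \<open>x = 0\<close> the form becomes \<open>y * z * (y + z)\<close>, so the curve
  meets this side line in two vertices and its point at infinity. The three side lines together give
  the six points of \<open>T_set\<close>.\<close>

lemma in_T_set_iff_on_curve:
  assumes ne: "(x, y, z) \<noteq> (0, 0, 0)" and F: "cubic a x y z = 0"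
  shows "hpoint x y z \<in> T_set \<longleftrightarrow> x * y * z = 0"
proof
  assume "hpoint x y z \<in> T_set"
  then show "x * y * z = 0"
    using ne by (auto simp: T_set_def hpoint_eq_iff)
next
  have mult: "hpoint x y z = hpoint x' y' z'"
    if "(x', y', z') \<noteq> (0, 0, 0)" "x = c * x'" "y = c * y'" "z = c * z'" for x' y' z' c
    using that ne hpoint_eq_iff[OF that(1) ne] by auto
  assume "x * y * z = 0"
  then consider "x = 0" | "y = 0" | "z = 0"
    by auto
  then show "hpoint x y z \<in> T_set"
  proof cases
    case 1
    then have "y = 0 \<or> z = 0 \<or> z = - y"
      using F by (auto simp: cubic_def)
    then show ?thesis
      using 1 mult[of 0 0 1 z] mult[of 0 1 0 y] mult[of 0 1 "- 1" y] by (auto simp: T_set_def)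
  next
    case 2
    then have "x = 0 \<or> z = 0 \<or> z = - x"
      using F by (auto simp: cubic_def)
    then show ?thesis
      using 2 mult[of 0 0 1 z] mult[of 1 0 0 x] mult[of 1 0 "- 1" x] by (auto simp: T_set_def)
  next
    case 3
    then have "x = 0 \<or> y = 0 \<or> y = - x"
      using F by (auto simp: cubic_def)
    then show ?thesis
      using 3 mult[of 0 1 0 y] mult[of 1 0 0 x] mult[of 1 "- 1" 0 x] by (auto simp: T_set_def)
  qed
qed

lemma in_side_points_iff:
  assumes "(x, y, z) \<noteq> (0, 0, 0)"
  shows "hpoint x y z \<in> side_points \<longleftrightarrow> x * y * z = 0"
proof
  assume "hpoint x y z \<in> side_points"
  then obtain x' y' z' where "(x', y', z') \<noteq> (0, 0, 0)" "x' * y' * z' = 0"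
    "hpoint x' y' z' = hpoint x y z"
    unfolding side_points_def by clarsimp
  then show "x * y * z = 0"
    using assms by (auto simp: hpoint_eq_iff)
next
  assume "x * y * z = 0"
  then show "hpoint x y z \<in> side_points"
    using assms unfolding side_points_def by blast
qed

text \<open>On the curve the product of the three sums equals
  \<open>- (a + 1) * (x * y * z)\<close>, so for \<open>a \<noteq> - 1\<close> the anticomplementary
  side lines are avoided once the sides of the triangle are.\<close>

lemma admissible_on_curve:
  assumes "cubic a x y z = 0" "a \<noteq> - 1"
  shows "admissible (x, y, z) \<longleftrightarrow> x * y * z \<noteq> 0"
proof -
  have "(x + y) * (x + z) * (y + z) = cubic a x y z - (a + 1) * (x * y * z)"
    by (simp add: cubic_def algebra_simps)
  then show ?thesis
    using assms by auto
qed

section \<open>The ratio locus\<close>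

text \<open>The weighted mean \<open>W\<close> satisfies
  \<open>n (Y - X) = - (m + n) (W - Y)\<close>, so the ratio is \<open>- (m + n) / n\<close>; the
  conclusion is this equation cleared of denominators.\<close>

lemma signed_ratio_iff:
  assumes "X \<noteq> W" "n \<noteq> 0"
    and W: "(m + n) *\<^sub>R W = m *\<^sub>R Y + n *\<^sub>R X"
  shows "signed_ratio X Y W r \<longleftrightarrow> (m + n) + r * n = 0"
proof -
  have "n *\<^sub>R (X - W) = m *\<^sub>R (W - Y)"
    using W by (simp add: algebra_simps)
  then have "Y \<noteq> W"
    using assms by auto
  have 1: "n *\<^sub>R (Y - X) = (- (m + n)) *\<^sub>R (W - Y)"
    using W by (simp add: algebra_simps)
  have "Y - X = r *\<^sub>R (W - Y) \<longleftrightarrow> n *\<^sub>R (Y - X) = n *\<^sub>R r *\<^sub>R (W - Y)"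
    using \<open>n \<noteq> 0\<close> by (simp only: scaleR_cancel_left) simp
  also have "\<dots> \<longleftrightarrow> ((m + n) + r * n) *\<^sub>R (W - Y) = 0"
    unfolding 1 by (auto simp: algebra_simps add_eq_0_iff)
  finally show ?thesis
    using \<open>Y \<noteq> W\<close> by (simp add: signed_ratio_def)
qed

section \<open>Barycentric coordinates and the centroid\<close>

lemma bary_scaleR:
  assumes "x + y + z \<noteq> 0"
  shows "(x + y + z) *\<^sub>R bary A B C (x, y, z) = x *\<^sub>R A + y *\<^sub>R B + z *\<^sub>R C"
  using assms by simp

lemma non_collinear_independent:
  fixes A B C :: "'a :: real_vector"
  assumes "\<not> collinear {A, B, C}" and "p *\<^sub>R (B - A) + q *\<^sub>R (C - A) = 0"
  shows "p = 0 \<and> q = 0"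
proof (rule ccontr)
  have nc: "\<not> collinear {0, B - A, C - A}" "\<not> collinear {0, C - A, B - A}"
    using assms(1) collinear_3[of B A C] by (simp_all add: insert_commute)
  assume "\<not> (p = 0 \<and> q = 0)"
  then consider "p \<noteq> 0" | "q \<noteq> 0"
    by auto
  then show False
  proof cases
    case 1
    have "p *\<^sub>R (B - A) = p *\<^sub>R ((- q / p) *\<^sub>R (C - A))"
      using 1 assms(2) by (simp add: eq_neg_iff_add_eq_0)
    then have "B - A = (- q / p) *\<^sub>R (C - A)"
      using 1 by (simp only: scaleR_cancel_left) simp
    then show False
      using nc(2) unfolding collinear_lemma by blast
  next
    case 2
    have "q *\<^sub>R (C - A) = q *\<^sub>R ((- p / q) *\<^sub>R (B - A))"
      using 2 assms(2) by (simp add: eq_neg_iff_add_eq_0 add.commute)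
    then have "C - A = (- p / q) *\<^sub>R (B - A)"
      using 2 by (simp only: scaleR_cancel_left) simp
    then show False
      using nc(1) unfolding collinear_lemma by blast
  qed
qed

text \<open>Clearing denominators turns the equality into a linear relation between the edge vectors
  from \<open>A\<close>, whose coefficients must vanish.\<close>

lemma bary_eq_centroid_imp:
  assumes "\<not> collinear {A, B, C}" and "x + y + z \<noteq> 0"
    and "bary A B C (x, y, z) = bary A B C (1, 1, 1)"
  shows "x = y \<and> x = z"
proof -
  have "3 *\<^sub>R bary A B C (1, 1, 1) = A + B + C"
    using bary_scaleR[of 1 1 1 A B C] by simp
  then have "(3 * (x + y + z)) *\<^sub>R bary A B C (x, y, z) = (x + y + z) *\<^sub>R (A + B + C)"
    using assms(3) by (metis mult.commute scaleR_scaleR)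
  then have "3 *\<^sub>R (x *\<^sub>R A + y *\<^sub>R B + z *\<^sub>R C) = (x + y + z) *\<^sub>R (A + B + C)"
    using bary_scaleR[OF assms(2), of A B C] by (metis scaleR_scaleR)
  then have "(3 * y - (x + y + z)) *\<^sub>R (B - A) + (3 * z - (x + y + z)) *\<^sub>R (C - A) = 0"
    by (simp add: vec_eq_iff algebra_simps)
  from non_collinear_independent[OF assms(1) this] show ?thesis
    by auto
qed

text \<open>Excludes \<open>V = G\<close> for \<open>P\<close> other than \<open>G\<close>.
  Differences of the coordinates of \<open>V\<close> factor, for instance as
  \<open>(x - y) * (x * y - z^2)\<close>.\<close>

lemma V_point_centroid_imp:
  assumes V: "V_point (x, y, z) = (v, v, v)" and "x * y * z \<noteq> 0"
  shows "x = y \<and> y = z"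
proof -
  have "(x - y) * (x * y - z^2) = y * (x^2 + x * z + z^2) - x * (y^2 + y * z + z^2)"
    "(y - z) * (y * z - x^2) = z * (x^2 + x * y + y^2) - y * (x^2 + x * z + z^2)"
    "(x - z) * (x * z - y^2) = z * (x^2 + x * y + y^2) - x * (y^2 + y * z + z^2)"
    by (simp_all add: power2_eq_square algebra_simps)
  then have "(x - y) * (x * y - z^2) = 0" "(y - z) * (y * z - x^2) = 0"
    "(x - z) * (x * z - y^2) = 0"
    using V by simp_all
  then have d: "x = y \<or> x * y = z^2" "y = z \<or> y * z = x^2" "x = z \<or> x * z = y^2"
    by simp_all
  then consider "x = y" | "y = z" | "x = z" | "x * y = z^2" "y * z = x^2" "x * z = y^2"
    by blast
  then show ?thesis
  proof cases
    case 1
    then show ?thesis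
      using d(2) assms(2) by (auto simp: power2_eq_square)
  next
    case 2
    then show ?thesis
      using d(1) assms(2) by (auto simp: power2_eq_square)
  next
    case 3
    then show ?thesis
      using d(1) assms(2) by (auto simp: power2_eq_square)
  next
    case 4
    \<comment> \<open>With all three quadratic factors zero, this sum of real squares vanishes. Over
      the complex numbers \<open>(1, w, w^2)\<close> with \<open>w\<close> a primitive cube root of
      unity would survive.\<close>
    have "(x - y)^2 + (y - z)^2 + (z - x)^2 =
        2 * (x^2 - y * z) + 2 * (y^2 - x * z) + 2 * (z^2 - x * y)"
      by (simp add: power2_eq_square algebra_simps)
    then have "(x - y)^2 + (y - z)^2 + (z - x)^2 = 0"
      by (simp add: 4)
    then have "(x - y)^2 = 0" "(y - z)^2 = 0"
      using zero_le_power2[of "x - y"] zero_le_power2[of "y - z"] zero_le_power2[of "z - x"]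
      by linarith+
    then show ?thesis
      by simp
  qed
qed

text \<open>Ordinariness of \<open>Z\<close> and, by the next lemma, of \<open>V\<close> becomes the
  statement that \<open>P\<close> lies off the curves with parameters -9 and 0.\<close>

lemma Z_point_sum:
  "x * (y - z)^2 + y * (z - x)^2 + z * (x - y)^2 = cubic (- 9) x y z"
  by (simp add: cubic_def power2_eq_square algebra_simps)

lemma V_point_sum:
  "x * (y^2 + y * z + z^2) + y * (x^2 + x * z + z^2) + z * (x^2 + x * y + y^2) = cubic 0 x y z"
  by (simp add: cubic_def power2_eq_square algebra_simps)

lemma signed_ratio_GZV_iff:
  assumes nc: "\<not> collinear {A, B, C}" and P: "x * y * z \<noteq> 0"
    and Z: "ordinary (Z_point (x, y, z))" and V: "ordinary (V_point (x, y, z))"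
  shows "signed_ratio (bary A B C (1, 1, 1)) (bary A B C (Z_point (x, y, z)))
    (bary A B C (V_point (x, y, z))) (a / 9) \<longleftrightarrow> cubic a x y z = 0"
proof -
  let ?G = "bary A B C (1, 1, 1)" and ?Z = "bary A B C (Z_point (x, y, z))"
    and ?V = "bary A B C (V_point (x, y, z))"
  \<comment> \<open>\<open>m\<close> is the coordinate sum of \<open>Z\<close>, and \<open>n\<close>
    that of \<open>V - Z\<close>, the constant triple with entries \<open>3 * (x * y * z)\<close>.
    They are the weights of \<open>Z\<close> and \<open>G\<close> in \<open>V\<close>.\<close>
  define m n where "m = cubic (- 9) x y z" and "n = 9 * (x * y * z)"
  have mn: "m + n = cubic 0 x y z"
    by (simp add: m_def n_def cubic_def)
  have "n \<noteq> 0"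
    using P by (simp add: n_def)
  moreover have "?G \<noteq> ?V"
  proof
    assume "?G = ?V"
    then have "x * (y^2 + y * z + z^2) = y * (x^2 + x * z + z^2) \<and>
        x * (y^2 + y * z + z^2) = z * (x^2 + x * y + y^2)"
      using V by (intro bary_eq_centroid_imp[OF nc]) auto
    then have "x = y \<and> y = z"
      using P by (intro V_point_centroid_imp) auto
    \<comment> \<open>With equal coordinates the triple of \<open>Z\<close> is zero, hence not
      ordinary.\<close>
    then show False
      using Z by simp
  qed
  moreover have "(m + n) *\<^sub>R ?V = m *\<^sub>R ?Z + n *\<^sub>R ?G"
  proof -
    have mZ: "m *\<^sub>R ?Z = (x * (y - z)^2) *\<^sub>R A + (y * (z - x)^2) *\<^sub>R B + (z * (x - y)^2) *\<^sub>R C"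
      using Z bary_scaleR[of "x * (y - z)^2" "y * (z - x)^2" "z * (x - y)^2" A B C]
      by (simp only: m_def Z_point_sum Z_point.simps ordinary.simps simp_thms)
    have mV: "(m + n) *\<^sub>R ?V = (x * (y^2 + y * z + z^2)) *\<^sub>R A
        + (y * (x^2 + x * z + z^2)) *\<^sub>R B + (z * (x^2 + x * y + y^2)) *\<^sub>R C"
      using V bary_scaleR[of "x * (y^2 + y * z + z^2)" "y * (x^2 + x * z + z^2)"
        "z * (x^2 + x * y + y^2)" A B C]
      by (simp only: mn V_point_sum V_point.simps ordinary.simps simp_thms)
    have nG: "n *\<^sub>R ?G = (3 * (x * y * z)) *\<^sub>R (A + B + C)"
      using bary_scaleR[of 1 1 1 A B C] by (simp add: n_def)
    show ?thesis
      unfolding mZ mV nG by (simp add: vec_eq_iff power2_eq_square algebra_simps)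
  qed
  ultimately have "signed_ratio ?G ?Z ?V (a / 9) \<longleftrightarrow> (m + n) + a / 9 * n = 0"
    by (intro signed_ratio_iff) auto
  also have "(m + n) + a / 9 * n = cubic a x y z"
    by (simp add: m_def n_def cubic_def)
  finally show ?thesis .
qed

lemma ratio_locus_eq:
  assumes nc: "\<not> collinear {A, B, C}" and a: "a \<notin> {0, - 1, - 9}"
  shows "ratio_locus A B C (a / 9) = real_points (E_curve a) - T_set"
proof -
  have "admissible (x, y, z) \<and> ordinary (Z_point (x, y, z)) \<and> ordinary (V_point (x, y, z)) \<and>
      signed_ratio (bary A B C (1, 1, 1)) (bary A B C (Z_point (x, y, z)))
        (bary A B C (V_point (x, y, z))) (a / 9) \<longleftrightarrow>
      cubic a x y z = 0 \<and> x * y * z \<noteq> 0" (is "?L \<longleftrightarrow> ?R") for x y z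
  proof
    assume ?L
    then show ?R
      using signed_ratio_GZV_iff[OF nc, of x y z a] by auto
  next
    assume R: ?R
    \<comment> \<open>On the curve the coordinate sums of \<open>Z\<close> and \<open>V\<close> are
      \<open>- (a + 9) * (x * y * z)\<close> and \<open>- a * (x * y * z)\<close>; this is where
      \<open>a = - 9\<close> and \<open>a = 0\<close> are excluded.\<close>
    have "cubic (- 9) x y z = cubic a x y z - (a + 9) * (x * y * z)"
      "cubic 0 x y z = cubic a x y z - a * (x * y * z)"
      by (simp_all add: cubic_def algebra_simps)
    then have "ordinary (Z_point (x, y, z))" "ordinary (V_point (x, y, z))"
      unfolding Z_point.simps V_point.simps ordinary.simps Z_point_sum V_point_sum
      using R a by auto
    then show ?L
      using R a signed_ratio_GZV_iff[OF nc, of x y z a] admissible_on_curve[of a x y z] by auto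
  qed
  then have "ratio_locus A B C (a / 9) = {hpoint x y z | x y z. cubic a x y z = 0 \<and> x * y * z \<noteq> 0}"
    unfolding ratio_locus_def by presburger
  also have "\<dots> = real_points (E_curve a) - T_set"
  proof -
    have "hpoint x y z \<notin> T_set" if "cubic a x y z = 0" "x * y * z \<noteq> 0" for x y z
      using that in_T_set_iff_on_curve[of x y z a] by auto
    moreover have "x * y * z \<noteq> 0"
      if "cubic a x y z = 0" "(x, y, z) \<noteq> (0, 0, 0)" "hpoint x y z \<notin> T_set" for x y z
      using that in_T_set_iff_on_curve[of x y z a] by auto
    ultimately show ?thesis
      unfolding real_points_E_curve by fastforce
  qed
  finally show ?thesis .
qed

section \<open>The homothety locus\<close>

lemma affine_map_comp:
  assumes "affine_map f" "affine_map g"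
  shows "affine_map (f \<circ> g)"
proof -
  obtain L b L' b' where "linear L" "f = (\<lambda>X. L X + b)" "linear L'" "g = (\<lambda>X. L' X + b')"
    using assms unfolding affine_map_def by auto
  then have "linear (L \<circ> L')" "f \<circ> g = (\<lambda>X. (L \<circ> L') X + (L b' + b))"
    by (auto simp: linear_compose linear_add)
  then show ?thesis
    unfolding affine_map_def by blast
qed

lemma affine_map_homothety: "affine_map (homothety Q k)"
  unfolding affine_map_def
proof (intro exI conjI)
  show "linear (\<lambda>X. k *\<^sub>R X)"
    by (rule linear_scaleR)
  show "homothety Q k = (\<lambda>X. k *\<^sub>R X + (Q - k *\<^sub>R Q))"
    by (auto simp: homothety_def algebra_simps)
qed

lemma affine_map_add_diff:
  assumes "affine_map f"
  shows "f (X + t *\<^sub>R (Y - W)) = f X + t *\<^sub>R (f Y - f W)"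
proof -
  obtain L b where "linear L" "f = (\<lambda>X. L X + b)"
    using assms unfolding affine_map_def by auto
  then show ?thesis
    by (simp add: linear_add linear_diff linear_scale)
qed

lemma basis_of_triangle:
  fixes A B C :: "real^2"
  assumes "\<not> collinear {A, B, C}"
  shows "independent {B - A, C - A}" "B - A \<noteq> C - A" "span {B - A, C - A} = UNIV"
proof -
  note indep = non_collinear_independent[OF assms]
  show ne: "B - A \<noteq> C - A"
    using indep[of 1 "- 1"] by auto
  show ind: "independent {B - A, C - A}"
  proof (rule independent_if_scalars_zero)
    fix f v
    assume "(\<Sum>v\<in>{B - A, C - A}. f v *\<^sub>R v) = 0" "v \<in> {B - A, C - A}"
    then show "f v = 0"
      using indep[of "f (B - A)" "f (C - A)"] ne by auto
  qed simp
  \<comment> \<open>Two independent vectors span the plane by dimension count.\<close>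
  have "UNIV \<subseteq> span {B - A, C - A}"
    using ind ne by (intro card_ge_dim_independent) auto
  then show "span {B - A, C - A} = UNIV"
    by auto
qed

lemma affine_map_eqI:
  assumes nc: "\<not> collinear {A, B, C}" and "affine_map f" "affine_map g"
    and eq: "f A = g A" "f B = g B" "f C = g C"
  shows "f = g"
proof -
  obtain L b L' b' where f: "linear L" "f = (\<lambda>X. L X + b)" and g: "linear L'" "g = (\<lambda>X. L' X + b')"
    using assms(2,3) unfolding affine_map_def by auto
  have "L (B - A) = f B - f A" "L' (B - A) = g B - g A"
    "L (C - A) = f C - f A" "L' (C - A) = g C - g A"
    by (simp_all add: f(2) g(2) linear_diff[OF f(1)] linear_diff[OF g(1)])
  then have "L v = L' v" if "v \<in> {B - A, C - A}" for v
    using that unfolding eq by auto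
  then have "L X = L' X" for X
    by (rule linear_eq_on_span[OF f(1) g(1), of "{B - A, C - A}"])
      (simp_all add: basis_of_triangle(3)[OF nc])
  then show ?thesis
    using eq(1) by (simp add: f(2) g(2))
qed

text \<open>The linear part is prescribed on the basis of edge vectors; the translation part then
  carries \<open>A\<close> to \<open>A'\<close>.\<close>

lemma affine_map_exists:
  assumes nc: "\<not> collinear {A, B, C}"
  shows "\<exists>f. affine_map f \<and> f A = A' \<and> f B = B' \<and> f C = C'"
proof -
  obtain L where L: "linear L" "\<forall>v\<in>{B - A, C - A}. L v = (if v = B - A then B' - A' else C' - A')"
    using linear_independent_extend[OF basis_of_triangle(1)[OF nc],
      of "\<lambda>v. if v = B - A then B' - A' else C' - A'"] by blast
  have "affine_map (\<lambda>X. L X + (A' - L A))"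
    using L(1) unfolding affine_map_def by blast
  moreover have "L (B - A) = B' - A'" "L (C - A) = C' - A'"
    using L(2) basis_of_triangle(2)[OF nc] by auto
  then have "L B = L A + B' - A'" "L C = L A + C' - A'"
    by (simp_all add: linear_diff[OF L(1)] diff_eq_eq)
  ultimately show ?thesis
    by (intro exI[of _ "\<lambda>X. L X + (A' - L A)"]) simp
qed

text \<open>Existence and uniqueness justify the definite description in
  \<open>trace_map\<close>.\<close>

lemma trace_map_spec:
  assumes nc: "\<not> collinear {A, B, C}"
  shows "affine_map (trace_map A B C (x, y, z)) \<and>
    trace_map A B C (x, y, z) A = bary A B C (0, y, z) \<and>
    trace_map A B C (x, y, z) B = bary A B C (x, 0, z) \<and>
    trace_map A B C (x, y, z) C = bary A B C (x, y, 0)"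
proof -
  let ?P = "\<lambda>f. affine_map f \<and>
    f A = bary A B C (0, y, z) \<and> f B = bary A B C (x, 0, z) \<and> f C = bary A B C (x, y, 0)"
  have "\<exists>!f. ?P f"
  proof (rule ex_ex1I)
    show "\<exists>f. ?P f"
      by (rule affine_map_exists[OF nc])
    show "f = g" if "?P f" "?P g" for f g
      by (rule affine_map_eqI[OF nc]) (use that in simp_all)
  qed
  then show ?thesis
    unfolding trace_map.simps by (rule theI')
qed

section \<open>The map M on the vertices and its linear part\<close>

lemma inv_homothety:
  assumes "k \<noteq> 0"
  shows "inv (homothety Q k) = homothety Q (1 / k)"
proof (rule inv_unique_comp)
  show "homothety Q k \<circ> homothety Q (1 / k) = id" "homothety Q (1 / k) \<circ> homothety Q k = id"
    using assms by (auto simp: homothety_def)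
qed

text \<open>The inverse has centre \<open>G\<close> and ratio -2, so it sends \<open>X\<close> to
  \<open>3 G - 2 X\<close>.\<close>

lemma inv_complement_map:
  "inv (complement_map A B C) X = A + B + C - 2 *\<^sub>R X"
  by (simp add: complement_map_def inv_homothety) (simp add: homothety_def vec_eq_iff field_simps)

lemma affine_map_M_map:
  assumes "\<not> collinear {A, B, C}"
  shows "affine_map (M_map A B C (x, y, z))"
  using trace_map_spec[OF assms]
  by (simp add: M_map_def complement_map_def inv_homothety affine_map_comp affine_map_homothety)

lemma bary_scale:
  assumes "c \<noteq> 0"
  shows "bary A B C (c * x, c * y, c * z) = bary A B C (x, y, z)"
proof -
  have "c * x + c * y + c * z = c * (x + y + z)"
    "(c * x) *\<^sub>R A + (c * y) *\<^sub>R B + (c * z) *\<^sub>R C = c *\<^sub>R (x *\<^sub>R A + y *\<^sub>R B + z *\<^sub>R C)"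
    by (simp_all add: algebra_simps)
  then show ?thesis
    using assms by simp
qed

text \<open>A point of \<open>BC\<close> goes to the parallel to \<open>BC\<close> through
  \<open>A\<close>. The form \<open>A + t (B - C)\<close> lets \<open>affine_map_add_diff\<close>
  compute its image under the trace map.\<close>

lemma anticomplement_of_side_point:
  fixes A B C :: "real^'n"
  assumes "q + p \<noteq> 0"
  shows "A + B + C - 2 *\<^sub>R ((1 / (q + p)) *\<^sub>R (p *\<^sub>R B + q *\<^sub>R C)) =
    A + ((q - p) / (q + p)) *\<^sub>R (B - C)"
  using assms by (simp add: vec_eq_iff divide_simps) (simp add: algebra_simps)

lemma M_map_vertices:
  assumes nc: "\<not> collinear {A, B, C}" and P: "admissible (x, y, z)"
  defines "D \<equiv> bary A B C (0, y, z)" and "E \<equiv> bary A B C (x, 0, z)" and "F \<equiv> bary A B C (x, y, 0)"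
  shows "M_map A B C (x, y, z) A = D + ((y - z) / (y + z)) *\<^sub>R (E - F)"
    and "M_map A B C (x, y, z) B = E + ((x - z) / (x + z)) *\<^sub>R (D - F)"
    and "M_map A B C (x, y, z) C = F + ((x - y) / (x + y)) *\<^sub>R (D - E)"
proof -
  let ?T = "trace_map A B C (x, y, z)"
  have ne: "x \<noteq> 0" "y \<noteq> 0" "z \<noteq> 0" "x + y \<noteq> 0" "x + z \<noteq> 0" "y + z \<noteq> 0"
    using P by auto
  have T: "affine_map ?T" "?T A = D" "?T B = E" "?T C = F"
    using trace_map_spec[OF nc, of x y z] by (simp_all add: D_def E_def F_def)
  have M: "M_map A B C (x, y, z) X =
      ?T (A + B + C - 2 *\<^sub>R trace_map A B C (y * z, x * z, x * y) X)" for X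
    by (simp add: M_map_def inv_complement_map)
  note T' = trace_map_spec[OF nc, of "y * z" "x * z" "x * y"]
  \<comment> \<open>The common factor \<open>x\<close> cancels from the trace of the isotomic
    conjugate.\<close>
  have "bary A B C (0, x * z, x * y) = bary A B C (0, z, y)"
    using bary_scale[of x A B C 0 z y] ne by (simp add: mult.commute del: bary.simps)
  then have "A + B + C - 2 *\<^sub>R bary A B C (0, x * z, x * y) = A + ((y - z) / (y + z)) *\<^sub>R (B - C)"
    using anticomplement_of_side_point[of y z A B C] ne by (simp add: ac_simps)
  then show "M_map A B C (x, y, z) A = D + ((y - z) / (y + z)) *\<^sub>R (E - F)"
    by (simp only: M T' T affine_map_add_diff[OF T(1)])
  have "bary A B C (y * z, 0, x * y) = bary A B C (z, 0, x)"
    using bary_scale[of y A B C z 0 x] ne by (simp add: mult.commute del: bary.simps)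
  then have "A + B + C - 2 *\<^sub>R bary A B C (y * z, 0, x * y) = B + ((x - z) / (x + z)) *\<^sub>R (A - C)"
    using anticomplement_of_side_point[of x z B A C] ne by (simp add: ac_simps)
  then show "M_map A B C (x, y, z) B = E + ((x - z) / (x + z)) *\<^sub>R (D - F)"
    by (simp only: M T' T affine_map_add_diff[OF T(1)])
  have "bary A B C (y * z, x * z, 0) = bary A B C (y, x, 0)"
    using bary_scale[of z A B C y x 0] ne by (simp add: mult.commute del: bary.simps)
  then have "A + B + C - 2 *\<^sub>R bary A B C (y * z, x * z, 0) = C + ((x - y) / (x + y)) *\<^sub>R (A - B)"
    using anticomplement_of_side_point[of x y C A B] ne by (simp add: ac_simps)
  then show "M_map A B C (x, y, z) C = F + ((x - y) / (x + y)) *\<^sub>R (D - E)"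
    by (simp only: M T' T affine_map_add_diff[OF T(1)])
qed

text \<open>Two independent edge vectors are scaled by the same factor, so the affine map M is a
  homothety, or a translation if \<open>\<kappa>\<close> is 1.\<close>

lemma M_map_linear_part:
  assumes nc: "\<not> collinear {A, B, C}" and P: "admissible (x, y, z)"
  defines "\<kappa> \<equiv> - 4 * (x * y * z) / ((x + y) * (x + z) * (y + z))"
  shows "M_map A B C (x, y, z) B - M_map A B C (x, y, z) A = \<kappa> *\<^sub>R (B - A)"
    and "M_map A B C (x, y, z) C - M_map A B C (x, y, z) A = \<kappa> *\<^sub>R (C - A)"
proof -
  have ne: "x + y \<noteq> 0" "x + z \<noteq> 0" "y + z \<noteq> 0"
    using P by auto
  show "M_map A B C (x, y, z) B - M_map A B C (x, y, z) A = \<kappa> *\<^sub>R (B - A)"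
    "M_map A B C (x, y, z) C - M_map A B C (x, y, z) A = \<kappa> *\<^sub>R (C - A)"
    unfolding M_map_vertices[OF nc P] \<kappa>_def using ne
    by (simp_all add: vec_eq_iff divide_simps) (simp_all add: algebra_simps)
qed

lemma affine_map_homothety_iff:
  assumes nc: "\<not> collinear {A, B, C}" and f: "affine_map f"
    and \<kappa>: "f B - f A = \<kappa> *\<^sub>R (B - A)" "f C - f A = \<kappa> *\<^sub>R (C - A)"
    and k: "k \<noteq> 0" "k \<noteq> 1"
  shows "homothety_with_ratio f k \<longleftrightarrow> k = \<kappa>"
proof
  assume "homothety_with_ratio f k"
  then obtain Q where "f = homothety Q k"
    by (auto simp: homothety_with_ratio_def)
  then have "f B - f A = k *\<^sub>R (B - A)"
    by (simp add: homothety_def algebra_simps)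
  moreover have "B - A \<noteq> 0"
    using nc by auto
  ultimately show "k = \<kappa>"
    using \<kappa>(1) by (metis scaleR_cancel_right)
next
  assume "k = \<kappa>"
  \<comment> \<open>The centre comes from solving \<open>Q + k (A - Q) = f A\<close>, which is
    possible as \<open>k \<noteq> 1\<close>.\<close>
  define Q where "Q = (1 / (1 - k)) *\<^sub>R (f A - k *\<^sub>R A)"
  have "(1 - k) *\<^sub>R Q = f A - k *\<^sub>R A"
    using k(2) by (simp add: Q_def)
  then have Q: "homothety Q k X = f A + k *\<^sub>R (X - A)" for X
    by (simp add: homothety_def algebra_simps)
  have "f = homothety Q k"
    by (intro affine_map_eqI[OF nc f affine_map_homothety])
      (simp_all only: Q, simp_all add: \<open>k = \<kappa>\<close> flip: \<kappa>)
  then show "homothety_with_ratio f k"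
    using k(1) by (auto simp: homothety_with_ratio_def)
qed

lemma homothety_locus_eq:
  assumes nc: "\<not> collinear {A, B, C}" and a: "a \<notin> {3, - 1}"
  shows "homothety_locus A B C (4 / (a + 1)) = real_points (E_curve a) - side_points"
proof -
  \<comment> \<open>The ratio 1 would occur exactly for \<open>a = 3\<close>.\<close>
  have k: "4 / (a + 1) \<noteq> 0" "4 / (a + 1) \<noteq> 1"
    using a by (auto simp: field_simps)
  have "admissible (x, y, z) \<and> homothety_with_ratio (M_map A B C (x, y, z)) (4 / (a + 1)) \<longleftrightarrow>
      cubic a x y z = 0 \<and> x * y * z \<noteq> 0" for x y z
  proof (cases "admissible (x, y, z)")
    case True
    define p q where "p = x * y * z" and "q = (x + y) * (x + z) * (y + z)"
    \<comment> \<open>In this form the vanishing of the cubic is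
      \<open>4 / (a + 1) = - 4 * p / q\<close> after cross-multiplication.\<close>
    have pq: "p \<noteq> 0" "q \<noteq> 0" "cubic a x y z = q + (a + 1) * p"
      using True by (auto simp: p_def q_def cubic_def algebra_simps)
    have "homothety_with_ratio (M_map A B C (x, y, z)) (4 / (a + 1)) \<longleftrightarrow> 4 / (a + 1) = - 4 * p / q"
      using M_map_linear_part[OF nc True] k unfolding p_def q_def
      by (intro affine_map_homothety_iff[OF nc affine_map_M_map[OF nc]]) auto
    also have "\<dots> \<longleftrightarrow> cubic a x y z = 0"
      using a pq by (auto simp: field_simps)
    finally show ?thesis
      using True pq(1) by (simp add: p_def)
  next
    case False
    then show ?thesis
      using admissible_on_curve[of a x y z] a by auto
  qed
  then have "homothety_locus A B C (4 / (a + 1)) =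
      {hpoint x y z | x y z. cubic a x y z = 0 \<and> x * y * z \<noteq> 0}"
    unfolding homothety_locus_def by presburger
  also have "\<dots> = real_points (E_curve a) - side_points"
  proof -
    have "hpoint x y z \<notin> side_points" if "x * y * z \<noteq> 0" for x y z
      using that in_side_points_iff[of x y z] by auto
    moreover have "x * y * z \<noteq> 0"
      if "(x, y, z) \<noteq> (0, 0, 0)" "hpoint x y z \<notin> side_points" for x y z
      using that in_side_points_iff[of x y z] by auto
    ultimately show ?thesis
      unfolding real_points_E_curve by fastforce
  qed
  finally show ?thesis .
qed

theorem theorem2p1:
  fixes A B C :: "real^2" and a :: real
  assumes "\<not> collinear {A, B, C}"
  shows "(a / 9 \<notin> {0, - 1 / 9, - 1} \<longrightarrow>
           elliptic_curve (E_curve a) \<and>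
           ratio_locus A B C (a / 9) = real_points (E_curve a) - T_set) \<and>
         (a \<notin> {3, 0, - 1, - 9} \<longrightarrow>
           elliptic_curve (E_curve a) \<and>
           homothety_locus A B C (4 / (a + 1)) = real_points (E_curve a) - side_points)"
proof -
  have "a \<notin> {0, - 1, - 9}" if "a / 9 \<notin> {0, - 1 / 9, - 1}"
    using that by auto
  then show ?thesis
    using elliptic_curve_E_curve ratio_locus_eq[OF assms] homothety_locus_eq[OF assms] by auto
qed

end
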